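(* For the Santa Claus problem on two uniformly related machines with speed ratio $s \ge 1$, no deterministic online algorithm has an online bounded ratio larger than $\frac1s$.
   Context: There are two machines with speeds $1$ and $s$. Jobs with positive sizes arrive online and each must be assigned irrevocably to one machine; the completion time of a machine is the total size of its jobs divided by its speed; the goal is to maximize the minimum completion time over the two machines. For a deterministic online algorithm $A$ of a maximization problem, $\textsc{Opt}_A$ denotes an offline algorithm that is optimal among offline algorithms whose solution on any input $I$ satisfies, for every prefix $I'$ of $I$, that the value of the solution restricted to $I'$ is at least $A(I')$. The online bounded ratio of $A$ is the supremum of all constants $c$ such that $A(I) \ge c\,\textsc{Opt}_A(I)$ for all inputs $I$. *)

theory Defs
  imports Complex_Main
begin

datatype machine = M1 | M2

fun speed :: "real \<Rightarrow> machine \<Rightarrow> real" where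
  "speed s M1 = 1"
| "speed s M2 = s"

definition valid_input :: "real list \<Rightarrow> bool" where
  "valid_input I \<longleftrightarrow> (\<forall>x\<in>set I. x > 0)"

text \<open>A solution for \<open>I\<close> is a list \<open>a\<close> with \<open>length a = length I\<close>; job \<open>I ! i\<close> runs on
  machine \<open>a ! i\<close>.\<close>

definition load :: "real list \<Rightarrow> machine list \<Rightarrow> machine \<Rightarrow> real" where
  "load I a m = (\<Sum>i | i < length I \<and> a ! i = m. I ! i)"

definition completion_time :: "real \<Rightarrow> real list \<Rightarrow> machine list \<Rightarrow> machine \<Rightarrow> real" where
  "completion_time s I a m = load I a m / speed s m"

definition objective :: "real \<Rightarrow> real list \<Rightarrow> machine list \<Rightarrow> real" where
  "objective s I a = min (completion_time s I a M1) (completion_time s I a M2)"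

text \<open>A deterministic online algorithm chooses a machine from the earlier jobs (in order of
  arrival) and the current job. Its earlier decisions need not be passed to it: by determinism
  they are functions of the earlier jobs.\<close>

type_synonym online_algorithm = "real list \<Rightarrow> real \<Rightarrow> machine"

definition run :: "online_algorithm \<Rightarrow> real list \<Rightarrow> machine list" where
  "run A I = map (\<lambda>i. A (take i I) (I ! i)) [0..<length I]"

definition alg_value :: "real \<Rightarrow> online_algorithm \<Rightarrow> real list \<Rightarrow> real" where
  "alg_value s A I = objective s I (run A I)"

definition bounded_solutions :: "real \<Rightarrow> online_algorithm \<Rightarrow> real list \<Rightarrow> machine list set" where
  "bounded_solutions s A I =
    {a. length a = length I \<and>
        (\<forall>k\<le>length I. objective s (take k I) (take k a) \<ge> alg_value s A (take k I))}"

text \<open>The value of \<open>Opt\<^sub>A\<close> on \<open>I\<close>. The set is finite and contains the solution of \<open>A\<close> itself,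
  so the maximum is attained; see \<open>Opt_value_optimal\<close> below.\<close>

definition Opt_value :: "real \<Rightarrow> online_algorithm \<Rightarrow> real list \<Rightarrow> real" where
  "Opt_value s A I = Max (objective s I ` bounded_solutions s A I)"

definition ratio_constants :: "real \<Rightarrow> online_algorithm \<Rightarrow> real set" where
  "ratio_constants s A = {c. \<forall>I. valid_input I \<longrightarrow> alg_value s A I \<ge> c * Opt_value s A I}"

text \<open>This set is nonempty and, for positive \<open>s\<close>, bounded above (shown below), so the real
  supremum is the intended one.\<close>

definition online_bounded_ratio :: "real \<Rightarrow> online_algorithm \<Rightarrow> real" where
  "online_bounded_ratio s A = Sup (ratio_constants s A)"

lemma length_run [simp]: "length (run A I) = length I"
  by (simp add: run_def)

lemma take_run: "k \<le> length I \<Longrightarrow> take k (run A I) = run A (take k I)"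
  by (rule nth_equalityI) (auto simp: run_def)

lemma run_bounded: "run A I \<in> bounded_solutions s A I"
  by (auto simp: bounded_solutions_def alg_value_def take_run)

lemma finite_bounded_solutions: "finite (bounded_solutions s A I)"
proof -
  have "(UNIV :: machine set) = {M1, M2}"
    using machine.exhaust by auto
  then have "finite (UNIV :: machine set)"
    by (metis finite.emptyI finite.insertI)
  then have "finite {a :: machine list. set a \<subseteq> UNIV \<and> length a = length I}"
    by (rule finite_lists_length_eq)
  then show ?thesis
    by (rule finite_subset[rotated]) (auto simp: bounded_solutions_def)
qed

lemma Opt_value_optimal:
  "\<exists>B. (\<forall>I. B I \<in> bounded_solutions s A I \<and> objective s I (B I) = Opt_value s A I) \<and>
       (\<forall>B'. (\<forall>I. B' I \<in> bounded_solutions s A I) \<longrightarrow>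
             (\<forall>I. objective s I (B' I) \<le> objective s I (B I)))"
proof -
  have fin: "finite (objective s I ` bounded_solutions s A I)" for I
    using finite_bounded_solutions by blast
  have "Opt_value s A I \<in> objective s I ` bounded_solutions s A I" for I
    unfolding Opt_value_def using fin run_bounded[of A I s] by (intro Max_in) auto
  then have "\<forall>I. \<exists>a. a \<in> bounded_solutions s A I \<and> objective s I a = Opt_value s A I"
    by (metis imageE)
  then obtain B where B:
    "\<And>I. B I \<in> bounded_solutions s A I \<and> objective s I (B I) = Opt_value s A I"
    by metis
  have "objective s I a \<le> Opt_value s A I" if "a \<in> bounded_solutions s A I" for I a
    unfolding Opt_value_def using that fin by (intro Max_ge) auto
  with B show ?thesis by (intro exI[of _ B]) auto
qed

lemma load_pair:
  "load [x, y] [a, b] m = (if a = m then x else 0) + (if b = m then y else 0)"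
proof -
  have "{i. i < length [x, y] \<and> [a, b] ! i = m} =
        (if a = m then {0} else {}) \<union> (if b = m then {1} else {})"
    by (auto simp: less_Suc_eq nth_Cons' split: if_splits)
  then show ?thesis by (simp add: load_def)
qed

lemma objective_short: "length I \<le> 1 \<Longrightarrow> s > 0 \<Longrightarrow> valid_input I \<Longrightarrow> objective s I a = 0"
proof -
  assume "length I \<le> 1" "s > 0" "valid_input I"
  then consider "I = []" | x where "I = [x]" "x > 0"
    by (cases I) (auto simp: valid_input_def)
  then show ?thesis
  proof cases
    case 1
    then show ?thesis by (simp add: objective_def completion_time_def load_def)
  next
    case 2
    have "load [x] a m = (if a ! 0 = m then x else 0)" for m
    proof -
      have "{i. i < length [x] \<and> a ! i = m} = (if a ! 0 = m then {0} else {})" by auto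
      then show ?thesis by (simp add: load_def)
    qed
    with 2 \<open>s > 0\<close> show ?thesis
      by (cases "a ! 0") (auto simp: objective_def completion_time_def)
  qed
qed

lemma zero_in_ratio_constants: "s > 0 \<Longrightarrow> 0 \<in> ratio_constants s A"
proof -
  assume "s > 0"
  then have "speed s m > 0" for m by (cases m) auto
  then have "alg_value s A I \<ge> 0" if "valid_input I" for I
    using that unfolding alg_value_def objective_def completion_time_def load_def
    using \<open>s > 0\<close>
    by (auto intro!: divide_nonneg_nonneg sum_nonneg simp: valid_input_def less_imp_le)
  then show ?thesis by (auto simp: ratio_constants_def)
qed

lemma bdd_above_ratio_constants:
  assumes "s > 0" shows "bdd_above (ratio_constants s A)"
proof -
  let ?I = "[1, 1] :: real list"
  have v: "valid_input ?I" by (simp add: valid_input_def)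
  have pos: "objective s ?I [M1, M2] > 0"
    using assms by (simp add: objective_def completion_time_def load_pair)
  have "Opt_value s A ?I > 0"
  proof (cases "alg_value s A ?I \<le> 0")
    case True
    have "objective s (take k ?I) (take k [M1, M2]) \<ge> alg_value s A (take k ?I)" if "k \<le> 2" for k
    proof (cases "k = 2")
      case True
      with \<open>alg_value s A ?I \<le> 0\<close> pos show ?thesis by (simp add: numeral_2_eq_2)
    next
      case False
      have "length (take k ?I) \<le> 1" using False that by auto
      moreover have "valid_input (take k ?I)"
        using v by (auto simp: valid_input_def dest: in_set_takeD)
      ultimately show ?thesis
        using assms by (simp add: alg_value_def objective_short)
    qed
    then have "[M1, M2] \<in> bounded_solutions s A ?I"
      by (auto simp: bounded_solutions_def)
    then have "objective s ?I [M1, M2] \<le> Opt_value s A ?I"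
      unfolding Opt_value_def using finite_bounded_solutions by (intro Max_ge) auto
    with pos show ?thesis by simp
  next
    case False
    have "alg_value s A ?I \<le> Opt_value s A ?I"
      unfolding Opt_value_def alg_value_def
      using finite_bounded_solutions run_bounded by (intro Max_ge) auto
    with False show ?thesis by simp
  qed
  then have "c \<le> alg_value s A ?I / Opt_value s A ?I" if "c \<in> ratio_constants s A" for c
    using that v by (simp add: ratio_constants_def pos_le_divide_eq)
  then show ?thesis by (rule bdd_aboveI)
qed

end

(* The adversary releases a job of size 1 and then one job that a solution with the first job on
   the other machine balances perfectly: if the first job is on M1, the second one has size 1 / s,
   and the swapped solution has value 1 / s against at most 1 / s^2; if it is on M2, the second one
   has size s, and the values are 1 against at most 1 / s. A prefix of a single job has value 0
   under every assignment, so the prefix constraints do not exclude the swapped solution. *)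
theory Submission
  imports Defs
begin

text \<open>Proper prefixes have value 0 under every assignment, so \<open>[a, b]\<close> is a
  bounded solution as soon as it is no worse than \<open>A\<close> on the whole input.\<close>

lemma objective_pair_le_Opt_value:
  assumes "s > 0" "valid_input [x, y]" "alg_value s A [x, y] \<le> objective s [x, y] [a, b]"
  shows "objective s [x, y] [a, b] \<le> Opt_value s A [x, y]"
proof -
  have "alg_value s A (take k [x, y]) \<le> objective s (take k [x, y]) (take k [a, b])"
    if "k \<le> 2" for k
  proof (cases "k = 2")
    case True
    with assms(3) show ?thesis by simp
  next
    case False
    with that have "length (take k [x, y]) \<le> 1" by auto
    moreover have "valid_input (take k [x, y])"
      using assms(2) by (auto simp: valid_input_def dest: in_set_takeD)
    ultimately show ?thesis
      using assms(1) by (simp add: alg_value_def objective_short)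
  qed
  then have "[a, b] \<in> bounded_solutions s A [x, y]"
    by (auto simp: bounded_solutions_def)
  then show ?thesis
    unfolding Opt_value_def using finite_bounded_solutions by (intro Max_ge) auto
qed

lemma ratio_constant_le_pair:
  assumes "s > 0" "valid_input [x, y]" "c \<in> ratio_constants s A" "r \<ge> 0"
    and "alg_value s A [x, y] \<le> r * objective s [x, y] [a, b]"
    and "alg_value s A [x, y] \<le> objective s [x, y] [a, b]"
    and "objective s [x, y] [a, b] > 0"
  shows "c \<le> r"
proof (rule ccontr)
  assume "\<not> c \<le> r"
  let ?v = "objective s [x, y] [a, b]"
  \<comment> \<open>\<open>Opt_value\<close> is only bounded from below here; the negated goal with
    \<open>r \<ge> 0\<close> makes \<open>c\<close> positive, so multiplying by \<open>c\<close>
    keeps the direction.\<close>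
  have "c * ?v \<le> c * Opt_value s A [x, y]"
    using objective_pair_le_Opt_value[OF assms(1,2,6)] \<open>\<not> c \<le> r\<close> assms(4)
    by (intro mult_left_mono) auto
  also have "\<dots> \<le> alg_value s A [x, y]"
    using assms(2,3) by (simp add: ratio_constants_def)
  also have "\<dots> \<le> r * ?v" by (fact assms(5))
  finally show False
    using assms(7) \<open>\<not> c \<le> r\<close> by simp
qed

lemma run_pair: "run A [x, y] = [A [] x, A [x] y]"
  by (simp add: run_def)

lemma ratio_constant_le_inverse_speed:
  assumes "s \<ge> 1" "c \<in> ratio_constants s A"
  shows "c \<le> 1 / s"
proof -
  have s: "s > 0" and inv: "1 / s \<le> 1" "1 / s \<ge> 0" using assms(1) by auto
  \<comment> \<open>This makes the swapped solution no worse than \<open>A\<close> when the first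
    job is on \<open>M1\<close>.\<close>
  have inv2: "1 / (s * s) \<le> 1 / s"
    using mult_left_mono[OF inv] by (simp add: field_simps)
  show ?thesis
  proof (cases "A [] 1")
    case M1
    have obj: "objective s [1, 1 / s] [M2, M1] = 1 / s"
      by (simp add: objective_def completion_time_def load_pair)
    \<comment> \<open>Either \<open>M2\<close> stays empty, or it gets only the job of size
      \<open>1 / s\<close> and finishes at \<open>1 / (s * s)\<close>.\<close>
    have "alg_value s A [1, 1 / s] \<le> 1 / (s * s)"
      using s M1 by (cases "A [1] (1 / s)")
        (auto simp: alg_value_def run_pair objective_def completion_time_def load_pair)
    then show ?thesis
      using s inv2 obj assms(2)
      by (intro ratio_constant_le_pair[of s 1 "1 / s" c A "1 / s" M2 M1])
        (auto simp: valid_input_def)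
  next
    case M2
    have obj: "objective s [1, s] [M1, M2] = 1"
      using s by (simp add: objective_def completion_time_def load_pair)
    have alg: "alg_value s A [1, s] \<le> 1 / s"
      using s M2 by (cases "A [1] s")
        (auto simp: alg_value_def run_pair objective_def completion_time_def load_pair)
    moreover have "alg_value s A [1, s] \<le> 1"
      using alg inv(1) by (rule order_trans)
    ultimately show ?thesis
      using s obj assms(2)
      by (intro ratio_constant_le_pair[of s 1 s c A "1 / s" M1 M2])
        (auto simp: valid_input_def)
  qed
qed

theorem theorem7:
  fixes s :: real
  assumes "s \<ge> 1"
  shows "\<not> (\<exists>A :: online_algorithm. online_bounded_ratio s A > 1 / s)"
proof -
  have "online_bounded_ratio s A \<le> 1 / s" for A
    unfolding online_bounded_ratio_def
    \<comment> \<open>Membership of 0 gives the nonemptiness that \<open>cSup_least\<close>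
      requires.\<close>
    using zero_in_ratio_constants[of s A] ratio_constant_le_inverse_speed[OF assms] assms
    by (intro cSup_least) auto
  then show ?thesis by (simp add: not_less)
qed

end
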